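(* Let $r\ge2$ and $n\ge1$ be integers and let $A_{r,n}^+(x)$ be the polynomial defined by $$\sum_{m\ge0}\bigl[(rm+1)^n-(rm)^n\bigr]x^m=\frac{A_{r,n}^+(x)}{(1-x)^n}.$$ Then $\mathcal{I}_{n-1}(A_{r,n}^+)\ll A_{r,n}^+$. In particular, $A_{r,n}^+(x)$ is alternatingly increasing.
   Context: $A_{r,n}^+(x)$ is the generating polynomial by descents of the $r$-colored permutations in $\mathbb{Z}_r\wr S_n$ with first coordinate of zero color; it has degree $n-1$. For $p$ of degree at most $d$, $\mathcal{I}_d(p)(x)=x^dp(1/x)$. For real-rooted real polynomials $f,g$ with zeros $\{r_i\}$, $\{s_j\}$ in decreasing order, $g\preceq f$ means either $\deg f=\deg g+1=d$ and $r_d\le s_{d-1}\le\cdots\le s_1\le r_1$, or $\deg f=\deg g=d$ and $s_d\le r_d\le\cdots\le s_1\le r_1$; $g\ll f$ means $g\preceq f$ with leading coefficients of the same sign, or $f\preceq g$ with leading coefficients of opposite sign. A polynomial $p=\sum_{j=0}^dp_jx^j$ of degree $d$ is alternatingly increasing if $0\le p_0\le p_d\le p_1\le p_{d-1}\le\cdots\le p_{\lfloor(d+1)/2\rfloor}$. *)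

theory Defs
  imports Complex_Main "HOL-Computational_Algebra.Computational_Algebra"
begin

definition colored_eulerian_plus :: "nat \<Rightarrow> nat \<Rightarrow> real poly" where
  "colored_eulerian_plus r n =
     (THE A. Abs_fps (\<lambda>m. (real r * real m + 1) ^ n - (real r * real m) ^ n)
             = fps_of_poly A / (1 - fps_X) ^ n)"

text \<open>The description above determines a unique polynomial.\<close>

lemma fps_power_times_one_minus_X:
  "\<exists>P :: real poly. Abs_fps (\<lambda>m. real m ^ j) * (1 - fps_X) ^ Suc j = fps_of_poly P"
proof (induction j)
  case 0
  have "Abs_fps (\<lambda>m. real m ^ 0) * (1 - fps_X) ^ Suc 0 = fps_of_poly 1"
    using inverse_mult_eq_1[of "1 - fps_X :: real fps"]
    by (simp add: fps_inverse_one_minus_fps_X)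
  thus ?case by blast
next
  case (Suc j)
  define M where "M = Abs_fps (\<lambda>m. real m ^ j)"
  define Y where "Y = (1 - fps_X :: real fps)"
  have dY: "fps_deriv Y = -1"
    by (simp add: Y_def)
  have step: "Abs_fps (\<lambda>m. real m ^ Suc j) = fps_X * fps_deriv M"
    by (rule fps_ext) (auto simp: M_def fps_X_mult_nth gr0_conv_Suc)
  from Suc obtain P where P: "M * Y ^ Suc j = fps_of_poly P"
    by (auto simp: M_def Y_def)
  have dpow: "fps_deriv (Y ^ Suc j) = - (of_nat (Suc j) * Y ^ j)"
    by (simp only: fps_deriv_power dY fps_of_nat diff_Suc_1 mult_minus_right mult_minus_left
        mult_1_right)
  have "fps_deriv (M * Y ^ Suc j) = fps_of_poly (pderiv P)"
    by (simp only: P fps_of_poly_pderiv)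
  hence D: "fps_deriv M * Y ^ Suc j - of_nat (Suc j) * (M * Y ^ j) = fps_of_poly (pderiv P)"
    unfolding fps_deriv_mult dpow by (simp add: algebra_simps)
  have "fps_X * fps_deriv M * Y ^ Suc (Suc j)
        = fps_X * Y * (fps_deriv M * Y ^ Suc j - of_nat (Suc j) * (M * Y ^ j))
          + of_nat (Suc j) * fps_X * (M * Y ^ Suc j)"
    by (simp add: algebra_simps)
  also have "\<dots> = fps_of_poly ([:0, 1:] * [:1, -1:] * pderiv P + of_nat (Suc j) * [:0, 1:] * P)"
  proof -
    have "Y = fps_of_poly [:1, -1:]"
      by (simp add: Y_def fps_of_poly_pCons)
    moreover have "of_nat (Suc j) = fps_of_poly (of_nat (Suc j) :: real poly)"
      by (simp only: of_nat_poly fps_of_poly_const fps_of_nat)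
    ultimately show ?thesis
      unfolding D P by (simp only: fps_of_poly_add fps_of_poly_mult fps_of_poly_fps_X)
  qed
  finally show ?case
    unfolding step Y_def[symmetric] by blast
qed

lemma colored_eulerian_plus_ex1:
  "\<exists>!A. Abs_fps (\<lambda>m. (real r * real m + 1) ^ n - (real r * real m) ^ n)
        = fps_of_poly A / (1 - fps_X) ^ n"
proof -
  let ?Y = "1 - fps_X :: real fps"
  let ?F = "Abs_fps (\<lambda>m. (real r * real m + 1) ^ n - (real r * real m) ^ n)"
  have unit: "(?Y ^ n) $ 0 \<noteq> 0"
    by simp
  have iff: "?F = fps_of_poly A / ?Y ^ n \<longleftrightarrow> ?F * ?Y ^ n = fps_of_poly A" for A
  proof -
    have inv: "inverse (?Y ^ n) * ?Y ^ n = 1"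
      by (rule inverse_mult_eq_1[OF unit])
    show ?thesis
    proof
      assume "?F = fps_of_poly A / ?Y ^ n"
      hence "?F * ?Y ^ n = fps_of_poly A * (inverse (?Y ^ n) * ?Y ^ n)"
        by (simp only: fps_divide_unit[OF unit] mult.assoc)
      thus "?F * ?Y ^ n = fps_of_poly A"
        by (simp only: inv mult_1_right)
    next
      assume "?F * ?Y ^ n = fps_of_poly A"
      hence "fps_of_poly A / ?Y ^ n = ?F * (inverse (?Y ^ n) * ?Y ^ n)"
        by (simp only: fps_divide_unit[OF unit] ac_simps flip: \<open>?F * ?Y ^ n = fps_of_poly A\<close>)
      thus "?F = fps_of_poly A / ?Y ^ n"
        by (simp only: inv mult_1_right)
    qed
  qed
  obtain P where P: "\<And>j. Abs_fps (\<lambda>m. real m ^ j) * ?Y ^ Suc j = fps_of_poly (P j)"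
    using fps_power_times_one_minus_X by metis
  have "?F = (\<Sum>j<n. fps_const (real (n choose j) * real r ^ j) * Abs_fps (\<lambda>m. real m ^ j))"
  proof (rule fps_ext)
    fix m
    have "(real r * real m + 1) ^ n
          = (\<Sum>j\<le>n. real (n choose j) * (real r * real m) ^ j)"
      by (subst binomial_ring) simp
    also have "{..n} = insert n {..<n}"
      by auto
    finally show "?F $ m
        = (\<Sum>j<n. fps_const (real (n choose j) * real r ^ j) * Abs_fps (\<lambda>m. real m ^ j)) $ m"
      by (simp add: fps_sum_nth power_mult_distrib mult.assoc)
  qed
  hence "?F * ?Y ^ n
      = (\<Sum>j<n. fps_const (real (n choose j) * real r ^ j) * Abs_fps (\<lambda>m. real m ^ j) * ?Y ^ n)"
    by (simp add: sum_distrib_right)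
  also have "\<dots> = (\<Sum>j<n. fps_of_poly
      (smult (real (n choose j) * real r ^ j) (P j * [:1, -1:] ^ (n - Suc j))))"
  proof (rule sum.cong[OF refl])
    fix j assume "j \<in> {..<n}"
    hence "?Y ^ n = ?Y ^ Suc j * ?Y ^ (n - Suc j)"
      by (metis Suc_leI le_add_diff_inverse lessThan_iff power_add)
    moreover have "?Y = fps_of_poly [:1, -1:]"
      by (simp add: fps_of_poly_pCons)
    ultimately show "fps_const (real (n choose j) * real r ^ j) * Abs_fps (\<lambda>m. real m ^ j) * ?Y ^ n
      = fps_of_poly (smult (real (n choose j) * real r ^ j) (P j * [:1, -1:] ^ (n - Suc j)))"
      using P[of j] by (simp only: fps_of_poly_mult fps_of_poly_power fps_of_poly_smult
        mult.assoc flip: P[of j])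
  qed
  also have "\<dots> = fps_of_poly (\<Sum>j<n.
      smult (real (n choose j) * real r ^ j) (P j * [:1, -1:] ^ (n - Suc j)))"
    by (simp add: fps_of_poly_sum)
  finally show ?thesis
    unfolding iff by (auto simp: fps_of_poly_eq_iff)
qed

text \<open>\<open>reversal d p\<close> is \<open>x\<^sup>d p(1/x)\<close>; it is only meaningful when \<open>degree p \<le> d\<close>.\<close>

definition reversal :: "nat \<Rightarrow> real poly \<Rightarrow> real poly" where
  "reversal d p = monom 1 (d - degree p) * reflect_poly p"

lemma poly_reversal:
  assumes "degree p \<le> d" and "x \<noteq> 0"
  shows "poly (reversal d p) x = x ^ d * poly p (1 / x)"
  using assms
  by (simp add: reversal_def poly_monom poly_reflect_poly_nz inverse_eq_divide
                mult.assoc[symmetric] power_add[symmetric])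

text \<open>The zero polynomial is not real-rooted in this sense; nonzero constants are.\<close>

definition real_rooted :: "real poly \<Rightarrow> bool" where
  "real_rooted p \<longleftrightarrow> (\<forall>z. poly (map_poly complex_of_real p) z = 0 \<longrightarrow> z \<in> \<real>)"

text \<open>The zeros with multiplicity, in decreasing order. The list is indexed from 0,
  so the zero usually called \<open>r\<^sub>1\<close> is \<open>zeros_desc p ! 0\<close>.\<close>

definition zeros_desc :: "real poly \<Rightarrow> real list" where
  "zeros_desc p = rev (sorted_list_of_multiset (proots p))"

definition interlaces :: "real poly \<Rightarrow> real poly \<Rightarrow> bool"  (infix "\<preceq>\<^sub>p" 50) where
  "g \<preceq>\<^sub>p f \<longleftrightarrow> real_rooted f \<and> real_rooted g \<and>
     (let r = zeros_desc f; s = zeros_desc g; d = degree f in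
        (d = degree g + 1 \<and>
           (\<forall>i. i + 1 < d \<longrightarrow> r ! (i + 1) \<le> s ! i \<and> s ! i \<le> r ! i)) \<or>
        (d = degree g \<and>
           (\<forall>i<d. s ! i \<le> r ! i) \<and>
           (\<forall>i. i + 1 < d \<longrightarrow> r ! (i + 1) \<le> s ! i)))"

definition signed_interlaces :: "real poly \<Rightarrow> real poly \<Rightarrow> bool"  (infix "\<lless>\<^sub>p" 50) where
  "g \<lless>\<^sub>p f \<longleftrightarrow>
     (g \<preceq>\<^sub>p f \<and> sgn (lead_coeff g) = sgn (lead_coeff f)) \<or>
     (f \<preceq>\<^sub>p g \<and> sgn (lead_coeff g) = - sgn (lead_coeff f))"

text \<open>With \<open>d = degree p\<close>, this is the chain
  \<open>0 \<le> p\<^sub>0 \<le> p\<^sub>d \<le> p\<^sub>1 \<le> p\<^bsub>d-1\<^esub> \<le> \<dots>\<close> ending at index \<open>\<lfloor>(d+1)/2\<rfloor>\<close>: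
  the links are \<open>p\<^sub>i \<le> p\<^bsub>d-i\<^esub>\<close> and \<open>p\<^bsub>d-i\<^esub> \<le> p\<^bsub>i+1\<^esub>\<close>. At the largest admissible \<open>i\<close> one of
  the two relates a coefficient to itself.\<close>

definition alternatingly_increasing :: "real poly \<Rightarrow> bool" where
  "alternatingly_increasing p \<longleftrightarrow>
     0 \<le> coeff p 0 \<and>
     (\<forall>i. 2 * i \<le> degree p \<longrightarrow> coeff p i \<le> coeff p (degree p - i)) \<and>
     (\<forall>i. 2 * i < degree p \<longrightarrow> coeff p (degree p - i) \<le> coeff p (i + 1))"

end

theory Submission
  imports Defs
begin

text \<open>
  Put \<open>P\<^sub>n(t, x) = (1 - x)\<^bsup>n+1\<^esup> \<Sum>\<^sub>m (m + t)\<^sup>n x\<^sup>m\<close> and \<open>h = 1/r\<close>. Up to the factor \<open>r\<^sup>n/(1 - x)\<close>, the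
  polynomial \<open>A\<close> of the theorem is \<open>P\<^sub>n(h, x) - P\<^sub>n(0, x)\<close> and its reversal is
  \<open>P\<^sub>n(1, x) - P\<^sub>n(1 - h, x)\<close>. For fixed \<open>x < 0\<close>, \<open>P\<^sub>n\<close> is as a function of \<open>t\<close> a multiple of a
  primitive of \<open>P\<^bsub>n-1\<^esub>\<close> with \<open>P\<^sub>n(0, x) = x P\<^sub>n(1, x)\<close>, so by Rolle it has at most one zero in
  \<open>[0, 1)\<close>. This determines the sign of \<open>A\<close> at the zeros of the Eulerian polynomial \<open>P\<^sub>n(1, x)\<close>, and
  the sign of the reversal at the zeros of \<open>A\<close>. Both alternate, which gives real-rootedness
  and strict interlacing.

  The coefficients of \<open>A\<close> are every \<open>r\<close>-th coefficient of the Eulerian polynomial times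
  \<open>(1 + x + \<dots> + x\<^bsup>r-1\<^esup>)\<^sup>n\<close>. That product is symmetric and unimodal of degree \<open>rn - 1\<close>, which gives
  the formula for the reversal and the alternatingly increasing property.
\<close>

section \<open>Real-rooted polynomials and sign changes\<close>

text \<open>One predicate carries all that the sign arguments use: degree \<open>d\<close>, positive
  leading coefficient and \<open>d\<close> simple real zeros.\<close>

definition desc_roots :: "real poly \<Rightarrow> nat \<Rightarrow> (nat \<Rightarrow> real) \<Rightarrow> bool" where
  "desc_roots p d w \<longleftrightarrow>
     (\<exists>c>0. p = smult c (\<Prod>i<d. [:- w i, 1:])) \<and> (\<forall>i. Suc i < d \<longrightarrow> w (Suc i) < w i)"

lemma less_of_Suc_less:
  fixes w :: "nat \<Rightarrow> 'a :: order"
  assumes "\<And>i. Suc i < d \<Longrightarrow> w (Suc i) < w i" "i < j" "j < d"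
  shows "w j < w i"
proof -
  have "Suc i \<le> j" using assms(2) by simp
  then show ?thesis using assms(3)
    by (induction j rule: dec_induct) (use assms(1) in \<open>blast, meson assms(1) Suc_lessD less_trans\<close>)
qed

lemma desc_roots_less:
  assumes "desc_roots p d w" "i < j" "j < d"
  shows "w j < w i"
  using assms less_of_Suc_less[of d w] by (auto simp: desc_roots_def)

lemma desc_roots_root:
  assumes "desc_roots p d w" "i < d"
  shows "poly p (w i) = 0"
  using assms by (auto simp: desc_roots_def poly_prod)

text \<open>Each factor with index in \<open>A\<close> is negative and costs one sign. Two index
  sets let this cover both a full product and one with a factor left out.\<close>

lemma sign_prod_diff:
  fixes w :: "nat \<Rightarrow> real"
  assumes "finite A" "finite B" "A \<inter> B = {}"
    and "\<And>i. i \<in> A \<Longrightarrow> x < w i" "\<And>i. i \<in> B \<Longrightarrow> w i < x"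
  shows "0 < (-1) ^ card A * (\<Prod>i\<in>A \<union> B. x - w i)"
proof -
  have "(-1) ^ card A * (\<Prod>i\<in>A. x - w i) = (\<Prod>i\<in>A. w i - x)"
    by (simp flip: prod_constant prod.distrib)
  moreover have "(\<Prod>i\<in>A. w i - x) > 0" "(\<Prod>i\<in>B. x - w i) > 0"
    using assms by (auto intro!: prod_pos)
  ultimately show ?thesis
    using assms by (simp add: prod.union_disjoint flip: mult.assoc)
qed

lemma desc_roots_sign:
  assumes "desc_roots p d w" "k \<le> d"
    and "\<And>i. i < k \<Longrightarrow> x < w i" "\<And>i. k \<le> i \<Longrightarrow> i < d \<Longrightarrow> w i < x"
  shows "0 < (-1) ^ k * poly p x"
proof -
  obtain c where c: "c > 0" "p = smult c (\<Prod>i<d. [:- w i, 1:])"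
    using assms(1) by (auto simp: desc_roots_def)
  have "0 < (-1) ^ card {..<k} * (\<Prod>i\<in>{..<k} \<union> {k..<d}. x - w i)"
    by (rule sign_prod_diff) (use assms in auto)
  moreover have "{..<k} \<union> {k..<d} = {..<d}"
    using assms(2) by auto
  ultimately show ?thesis
    using c by (simp add: poly_prod zero_less_mult_iff mult.left_commute)
qed

text \<open>As the zeros decrease, it is enough to compare \<open>x\<close> with its two neighbours,
  or with one of them at the ends \<open>k = 0\<close> and \<open>k = d\<close>.\<close>

lemma desc_roots_sign_between:
  assumes "desc_roots p d w" "k \<le> d"
    and "k > 0 \<Longrightarrow> x < w (k - 1)" "k < d \<Longrightarrow> w k < x"
  shows "0 < (-1) ^ k * poly p x"
proof (rule desc_roots_sign[OF assms(1,2)])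
  fix i assume "i < k"
  then show "x < w i"
    using desc_roots_less[OF assms(1), of i "k - 1"] assms by (cases "i = k - 1") force+
next
  fix i assume "k \<le> i" "i < d"
  then show "w i < x"
    using desc_roots_less[OF assms(1), of k i] assms by (cases "i = k") force+
qed

text \<open>At a simple zero only the term of the derivative without the factor of that zero
  survives, and \<open>k\<close> of its linear factors are negative there.\<close>

lemma desc_roots_sign_pderiv:
  assumes "desc_roots p d w" "k < d"
  shows "0 < (-1) ^ k * poly (pderiv p) (w k)"
proof -
  obtain c where c: "c > 0" "p = smult c (\<Prod>i<d. [:- w i, 1:])"
    using assms(1) by (auto simp: desc_roots_def)
  define q where "q = smult c (\<Prod>i\<in>{..<d} - {k}. [:- w i, 1:])"
  have "p = [:- w k, 1:] * q"
    using assms(2) by (simp only: c q_def prod.remove[of "{..<d}" k] finite_lessThan lessThan_iff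
        mult_smult_right)
  hence "poly (pderiv p) (w k) = poly q (w k)"
    by (simp add: pderiv_mult pderiv_pCons del: mult_pCons_left)
  moreover have "0 < (-1) ^ card {..<k} * (\<Prod>i\<in>{..<k} \<union> {Suc k..<d}. w k - w i)"
    by (rule sign_prod_diff) (use desc_roots_less[OF assms(1)] assms(2) in auto)
  moreover have "{..<k} \<union> {Suc k..<d} = {..<d} - {k}"
    using assms(2) by auto
  ultimately show ?thesis
    using c by (simp add: q_def poly_prod zero_less_mult_iff mult.left_commute)
qed

text \<open>The difference of the two sides vanishes on \<open>A\<close>, so if nonzero it would
  have degree exactly \<open>card A\<close>; but the coefficients at that degree cancel.\<close>

lemma poly_eq_smult_prod_roots:
  fixes p :: "real poly"
  assumes "degree p = card A" "finite A" "\<And>a. a \<in> A \<Longrightarrow> poly p a = 0"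
  shows "p = smult (lead_coeff p) (\<Prod>a\<in>A. [:- a, 1:])"
proof (rule ccontr)
  let ?q = "\<Prod>a\<in>A. [:- a, 1:]"
  assume ne: "p \<noteq> smult (lead_coeff p) ?q"
  let ?e = "p - smult (lead_coeff p) ?q"
  have deg: "degree ?q = card A"
    by (simp add: degree_prod_eq_sum_degree)
  have lead: "lead_coeff ?q = 1"
    by (simp add: lead_coeff_prod)
  have e0: "?e \<noteq> 0"
    using ne by simp
  have "A \<subseteq> {x. poly ?e x = 0}"
    using assms by (auto simp: poly_prod)
  hence "card A \<le> degree ?e"
    using card_poly_roots_bound[OF e0] poly_roots_finite[OF e0]
    by (meson card_mono le_trans)
  moreover have "degree ?e \<le> card A"
    by (rule degree_diff_le) (use assms deg in auto)
  ultimately have d: "degree ?e = card A"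
    by simp
  have "coeff ?e (card A) = 0"
    using lead deg assms(1) by simp
  thus False
    using e0 d by (metis leading_coeff_0_iff)
qed

lemma desc_rootsI:
  assumes "degree p = d" "lead_coeff p > 0"
    and "\<And>i. i < d \<Longrightarrow> poly p (w i) = 0" "\<And>i. Suc i < d \<Longrightarrow> w (Suc i) < w i"
  shows "desc_roots p d w"
proof -
  have lt: "w j < w i" if "i < j" "j < d" for i j
    using assms(4) that by (rule less_of_Suc_less)
  have inj: "inj_on w {..<d}"
    by (rule inj_onI) (metis lessThan_iff less_irrefl lt nat_neq_iff)
  have "p = smult (lead_coeff p) (\<Prod>a\<in>w ` {..<d}. [:- a, 1:])"
    by (rule poly_eq_smult_prod_roots) (use assms inj in \<open>auto simp: card_image\<close>)
  hence "p = smult (lead_coeff p) (\<Prod>i<d. [:- w i, 1:])"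
    by (simp add: prod.reindex[OF inj])
  thus ?thesis
    unfolding desc_roots_def using assms by blast
qed

text \<open>The reflected polynomial \<open>(-1) ^ degree p * p(-x)\<close> has the same leading
  coefficient as \<open>p\<close>, hence is positive for large arguments.\<close>

lemma ex_sign_at_minus_infinity:
  fixes p :: "real poly"
  assumes "lead_coeff p > 0"
  shows "\<exists>x<a. 0 < (-1) ^ degree p * poly p x"
proof -
  let ?q = "smult ((-1) ^ degree p) (pcompose p [:0, -1:])"
  have "lead_coeff ?q = lead_coeff p"
    using lead_coeff_comp[of "[:0, -1:]" p] by (simp flip: power_mult_distrib mult.assoc)
  then obtain m where m: "\<And>x. x \<ge> m \<Longrightarrow> poly ?q x \<ge> lead_coeff p"
    using poly_pinfty_gt_lc[of ?q] assms by auto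
  have "poly ?q (max m (1 - a)) > 0"
    using m[of "max m (1 - a)"] assms by linarith
  thus ?thesis
    by (intro exI[of _ "- max m (1 - a)"]) (auto simp: poly_pcompose)
qed

text \<open>The intermediate value theorem puts a zero into each gap between consecutive sample
  points. One more lies to the left of them all, since the sign at minus infinity differs from that
  at the last point. The zeros of the Eulerian polynomials, of the colored polynomial and of its
  reversal are all obtained in this way.\<close>

lemma desc_roots_of_sign_changes:
  assumes deg: "degree p = d" and lead: "lead_coeff p > 0"
    and x: "\<And>i. Suc i < d \<Longrightarrow> x (Suc i) < x i"
    and sgn: "\<And>i. i < d \<Longrightarrow> 0 < (-1) ^ i * poly p (x i)"
  obtains w where "desc_roots p d w" "\<And>i. i < d \<Longrightarrow> w i < x i"
    "\<And>i. Suc i < d \<Longrightarrow> x (Suc i) < w i"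
proof -
  have "\<exists>r<x i. poly p r = 0 \<and> (Suc i < d \<longrightarrow> x (Suc i) < r)" if i: "i < d" for i
  proof -
    \<comment> \<open>\<open>y\<close> is the next sample point, or a point far to the left if
      \<open>i\<close> is the last index.\<close>
    obtain y where y: "y < x i" "0 < (-1) ^ Suc i * poly p y" "Suc i < d \<longrightarrow> y = x (Suc i)"
    proof (cases "Suc i < d")
      case True
      then show ?thesis using that x sgn by blast
    next
      case False
      hence "d = Suc i" using i by simp
      thus ?thesis
        using that ex_sign_at_minus_infinity[OF lead, of "x i"] deg by auto
    qed
    have "poly p y * poly p (x i) < 0"
    proof -
      have "((-1) ^ i * poly p (x i)) * ((-1) ^ Suc i * poly p y) > 0"
        using sgn[OF i] y(2) by (rule mult_pos_pos)
      moreover have "((-1) ^ i * poly p (x i)) * ((-1) ^ Suc i * poly p y)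
          = - (((-1) ^ i * (-1) ^ i) * (poly p y * poly p (x i)))"
        by (simp add: ac_simps)
      moreover have "(-1) ^ i * (-1) ^ i = (1 :: real)"
        by (simp flip: power_mult_distrib)
      ultimately show ?thesis
        by (simp only: mult_1_left neg_0_less_iff_less)
    qed
    from poly_IVT[OF y(1) this] show ?thesis using y(3) by auto
  qed
  then obtain w where w: "\<And>i. i < d \<Longrightarrow> w i < x i \<and> poly p (w i) = 0 \<and> (Suc i < d \<longrightarrow> x (Suc i) < w i)"
    by metis
  have desc: "w (Suc i) < w i" if "Suc i < d" for i
    using w[of i] w[of "Suc i"] that by linarith
  have "desc_roots p d w"
    by (rule desc_rootsI[OF deg lead]) (use w desc in auto)
  thus ?thesis
    by (rule that) (use w in auto)
qed

section \<open>From \<open>desc_roots\<close> to real-rootedness, lists of zeros and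
  interlacing\<close>

lemma desc_roots_lead_coeff:
  assumes "desc_roots p d w"
  shows "lead_coeff p > 0" "degree p = d"
proof -
  obtain c where c: "c > 0" "p = smult c (\<Prod>i<d. [:- w i, 1:])"
    using assms by (auto simp: desc_roots_def)
  show "degree p = d"
    using c by (simp add: degree_prod_eq_sum_degree)
  have "lead_coeff p = c * lead_coeff (\<Prod>i<d. [:- w i, 1:])"
    using c by simp
  also have "\<dots> = c"
    by (simp only: lead_coeff_prod) simp
  finally show "lead_coeff p > 0"
    using c by simp
qed

lemma desc_roots_zeros_desc:
  assumes "desc_roots p d w"
  shows "zeros_desc p = map w [0..<d]"
proof -
  obtain c where c: "c > 0" "p = smult c (\<Prod>i<d. [:- w i, 1:])"
    using assms by (auto simp: desc_roots_def)
  have "proots p = (\<Sum>i<d. {#w i#})"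
    using c by (simp add: proots_prod)
  also have "\<dots> = mset (map w [0..<d])"
    by (induction d) auto
  \<comment> \<open>A multiset ignores order, and the reversed list is the ascending one, which
    sorting leaves unchanged.\<close>
  also have "\<dots> = mset (rev (map w [0..<d]))"
    by simp
  finally have "zeros_desc p = rev (sort (rev (map w [0..<d])))"
    unfolding zeros_desc_def by (simp only: sorted_list_of_multiset_mset)
  moreover have "sorted (rev (map w [0..<d]))"
    unfolding sorted_wrt_rev
    by (auto simp: sorted_wrt_iff_nth_less intro!: less_imp_le desc_roots_less[OF assms])
  ultimately show ?thesis
    by (simp add: sort_key_id_if_sorted)
qed

text \<open>Over the complex numbers the product stays split, which shows that all complex zeros are
  among the real numbers \<open>w i\<close>.\<close>

lemma poly_of_real_prod:
  fixes w :: "nat \<Rightarrow> real"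
  shows
  "poly (map_poly complex_of_real (smult c (\<Prod>i<d. [:- w i, 1:]))) z
     = of_real c * (\<Prod>i<d. z - of_real (w i))"
proof -
  have lin: "map_poly complex_of_real ([:- a, 1:] * q) = [:- of_real a, 1:] * map_poly of_real q" for a q
    by (rule poly_eqI) (auto simp: coeff_map_poly coeff_pCons split: nat.splits)
  have "map_poly complex_of_real (\<Prod>i<d. [:- w i, 1:]) = (\<Prod>i<d. [:- of_real (w i), 1:])"
  proof (induction d)
    case (Suc d)
    then show ?case
      by (simp only: prod.lessThan_Suc mult.commute[of _ "[:- w d, 1:]"]
          mult.commute[of _ "[:- of_real (w d), 1:]"] lin)
  qed auto
  thus ?thesis
    by (simp add: map_poly_smult poly_prod)
qed

lemma desc_roots_real_rooted:
  assumes "desc_roots p d w"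
  shows "real_rooted p"
  using assms by (auto simp: desc_roots_def real_rooted_def poly_of_real_prod)

lemma signed_interlaces_desc_roots:
  assumes "desc_roots p d z" "desc_roots q d w"
    and "\<And>i. i < d \<Longrightarrow> w i \<le> z i" "\<And>i. Suc i < d \<Longrightarrow> z (Suc i) \<le> w i"
  shows "q \<lless>\<^sub>p p"
  using assms desc_roots_real_rooted[OF assms(1)] desc_roots_real_rooted[OF assms(2)]
    desc_roots_lead_coeff[OF assms(1)] desc_roots_lead_coeff[OF assms(2)]
  by (auto simp: signed_interlaces_def interlaces_def desc_roots_zeros_desc Let_def)

section \<open>Eulerian polynomials and their shifts\<close>

text \<open>The Eulerian polynomials with constant term 1. The recurrence expresses how the operator
  sending F to (x F)', which multiplies the m-th coefficient by m + 1, acts on numerators over (1 -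
  x)^(n+1).\<close>

primrec eulerian :: "nat \<Rightarrow> real poly" where
  "eulerian 0 = 1"
| "eulerian (Suc n) = [:1, real n:] * eulerian n + [:0, 1, -1:] * pderiv (eulerian n)"

declare eulerian.simps(2) [simp del]

lemma fps_of_poly_one_minus_X: "fps_of_poly [:1, -1 :: real:] = 1 - fps_X"
  by (simp add: fps_of_poly_pCons)

lemma fps_of_poly_eulerian:
  "fps_of_poly (eulerian n) = (1 - fps_X) ^ Suc n * Abs_fps (\<lambda>m. (real m + 1) ^ n)"
proof (induction n)
  case 0
  show ?case
    using inverse_mult_eq_1'[of "1 - fps_X :: real fps"]
    by (simp add: fps_inverse_one_minus_fps_X)
next
  case (Suc n)
  define S where "S = Abs_fps (\<lambda>m. (real m + 1) ^ n)"
  define Y where "Y = (1 - fps_X :: real fps)"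
  have step: "Abs_fps (\<lambda>m. (real m + 1) ^ Suc n) = S + fps_X * fps_deriv S"
    by (rule fps_ext) (auto simp: S_def fps_X_mult_nth algebra_simps)
  have IH: "fps_of_poly (eulerian n) = Y ^ Suc n * S"
    using Suc by (simp add: S_def Y_def)
  have dpow: "fps_deriv (Y ^ Suc n) = - (of_nat (Suc n) * Y ^ n)"
  proof -
    have dY: "fps_deriv Y = -1"
      by (simp add: Y_def)
    show ?thesis
      by (simp only: fps_deriv_power dY fps_of_nat diff_Suc_1 mult_minus_right mult_minus_left
        mult_1_right)
  qed
  have D: "fps_of_poly (pderiv (eulerian n)) = Y ^ Suc n * fps_deriv S - of_nat (Suc n) * Y ^ n * S"
    unfolding fps_of_poly_pderiv IH fps_deriv_mult dpow by (simp add: algebra_simps)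
  have c1: "fps_of_poly [:1, real n:] = Y + of_nat (Suc n) * fps_X"
    by (simp add: Y_def fps_of_poly_pCons fps_of_nat algebra_simps)
  have c2: "fps_of_poly [:0, 1, -1 :: real:] = fps_X * Y"
    by (simp add: Y_def fps_of_poly_pCons algebra_simps)
  have "fps_of_poly (eulerian (Suc n)) = (Y + of_nat (Suc n) * fps_X) * (Y ^ Suc n * S)
     + fps_X * Y * (Y ^ Suc n * fps_deriv S - of_nat (Suc n) * Y ^ n * S)"
    unfolding eulerian.simps fps_of_poly_add fps_of_poly_mult D IH c1 c2 by (rule refl)
  also have "\<dots> = Y ^ Suc (Suc n) * (S + fps_X * fps_deriv S)"
    by (simp add: algebra_simps)
  finally show ?case
    unfolding step Y_def[symmetric] .
qed

text \<open>The polynomial \<open>(1 - x)\<^bsup>n+1\<^esup> \<Sum>\<^sub>m (m + t)\<^sup>n x\<^sup>m\<close>, an Appell sequence in \<open>t\<close>, expanded about \<open>t = 1\<close>.\<close>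

definition shifted_eulerian :: "nat \<Rightarrow> real \<Rightarrow> real poly" where
  "shifted_eulerian n t =
     (\<Sum>j\<le>n. smult (real (n choose j) * (t - 1) ^ (n - j)) ([:1, -1:] ^ (n - j) * eulerian j))"

text \<open>Expand (m + t)^n binomially in m + 1 and t - 1; the factors (1 - x)^(n-j) bring the
  resulting series to the common denominator (1 - x)^(n+1).\<close>

lemma fps_of_poly_shifted_eulerian:
  "fps_of_poly (shifted_eulerian n t) = (1 - fps_X) ^ Suc n * Abs_fps (\<lambda>m. (real m + t) ^ n)"
proof -
  let ?Y = "1 - fps_X :: real fps"
  let ?S = "\<lambda>j. Abs_fps (\<lambda>m. (real m + 1) ^ j)"
  have expand: "Abs_fps (\<lambda>m. (real m + t) ^ n)
      = (\<Sum>j\<le>n. fps_const (real (n choose j) * (t - 1) ^ (n - j)) * ?S j)"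
  proof (rule fps_ext)
    fix m
    have "(real m + t) ^ n = ((real m + 1) + (t - 1)) ^ n"
      by simp
    also have "\<dots> = (\<Sum>j\<le>n. real (n choose j) * (real m + 1) ^ j * (t - 1) ^ (n - j))"
      by (rule binomial_ring)
    finally show "Abs_fps (\<lambda>m. (real m + t) ^ n) $ m
        = (\<Sum>j\<le>n. fps_const (real (n choose j) * (t - 1) ^ (n - j)) * ?S j) $ m"
      by (simp add: fps_sum_nth ac_simps)
  qed
  have "fps_of_poly (shifted_eulerian n t)
      = (\<Sum>j\<le>n. fps_const (real (n choose j) * (t - 1) ^ (n - j)) * (?Y ^ (n - j) * (?Y ^ Suc j * ?S j)))"
    unfolding shifted_eulerian_def
    by (simp only: fps_of_poly_sum fps_of_poly_smult fps_of_poly_mult fps_of_poly_power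
        fps_of_poly_one_minus_X fps_of_poly_eulerian)
  also have "\<dots> = (\<Sum>j\<le>n. ?Y ^ Suc n * (fps_const (real (n choose j) * (t - 1) ^ (n - j)) * ?S j))"
  proof (rule sum.cong[OF refl])
    fix j assume "j \<in> {..n}"
    hence "?Y ^ Suc n = ?Y ^ (n - j) * ?Y ^ Suc j"
      by (simp flip: power_add)
    thus "fps_const (real (n choose j) * (t - 1) ^ (n - j)) * (?Y ^ (n - j) * (?Y ^ Suc j * ?S j))
        = ?Y ^ Suc n * (fps_const (real (n choose j) * (t - 1) ^ (n - j)) * ?S j)"
      by (simp only: ac_simps)
  qed
  finally show ?thesis
    unfolding expand by (simp only: sum_distrib_left)
qed

lemma shifted_eulerian_1: "shifted_eulerian n 1 = eulerian n"
  by (simp only: fps_of_poly_eq_iff[symmetric] fps_of_poly_shifted_eulerian fps_of_poly_eulerian)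

text \<open>The term with m = 0 vanishes, so the series is the one for t = 1 moved by one place. For
  x < 0 the values at t = 0 and t = 1 thus have opposite signs or are both zero.\<close>

lemma shifted_eulerian_0:
  assumes "n > 0"
  shows "shifted_eulerian n 0 = [:0, 1:] * eulerian n"
proof -
  have "Abs_fps (\<lambda>m. (real m + 0) ^ n) = fps_X * Abs_fps (\<lambda>m. (real m + 1) ^ n)"
    by (rule fps_ext) (use assms in \<open>auto simp: fps_X_mult_nth\<close>)
  thus ?thesis
    by (simp only: fps_of_poly_eq_iff[symmetric] fps_of_poly_shifted_eulerian fps_of_poly_eulerian
        fps_of_poly_mult fps_of_poly_fps_X ac_simps)
qed

text \<open>This is termwise differentiation of (m + t)^(n+1), carried out on the finite expansion;
  the factor \<open>1 - x\<close> comes from the normalising powers n + 2 and n + 1.\<close>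

lemma has_field_derivative_shifted_eulerian:
  "((\<lambda>t. poly (shifted_eulerian (Suc n) t) x) has_field_derivative
     real (Suc n) * (1 - x) * poly (shifted_eulerian n t) x) (at t)"
proof -
  define e where "e = (\<lambda>j. poly (eulerian j) x)"
  have eval: "poly (shifted_eulerian k s) x
      = (\<Sum>j\<le>k. real (k choose j) * (s - 1) ^ (k - j) * ((1 - x) ^ (k - j) * e j))" for k s
    by (simp add: shifted_eulerian_def poly_sum e_def)
  have top: "poly (shifted_eulerian (Suc n) s) x
      = (\<Sum>j\<le>n. real (Suc n choose j) * (s - 1) ^ (Suc n - j) * ((1 - x) ^ (Suc n - j) * e j)) + e (Suc n)" for s
    by (simp add: eval)
  have "((\<lambda>s. poly (shifted_eulerian (Suc n) s) x) has_field_derivative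
      (\<Sum>j\<le>n. real (Suc n choose j) * (real (Suc n - j) * (t - 1) ^ (n - j)) * ((1 - x) ^ (Suc n - j) * e j))) (at t)"
    unfolding top
    by (auto intro!: derivative_eq_intros sum.cong)
  also have "(\<Sum>j\<le>n. real (Suc n choose j) * (real (Suc n - j) * (t - 1) ^ (n - j)) * ((1 - x) ^ (Suc n - j) * e j))
      = real (Suc n) * (1 - x) * poly (shifted_eulerian n t) x"
    unfolding eval sum_distrib_left
  proof (rule sum.cong[OF refl])
    fix j assume j: "j \<in> {..n}"
    have "(Suc n - j) * (Suc n choose j) = Suc n * (n choose j)"
      using binomial_absorb_comp[of "Suc n" j] by simp
    hence b: "real (Suc n choose j) * real (Suc n - j) = real (Suc n) * real (n choose j)"
      by (metis mult.commute of_nat_mult)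
    have "real (Suc n choose j) * (real (Suc n - j) * (t - 1) ^ (n - j)) * ((1 - x) ^ (Suc n - j) * e j)
        = (real (Suc n choose j) * real (Suc n - j)) * ((t - 1) ^ (n - j) * (1 - x) ^ (Suc n - j) * e j)"
      by (simp only: ac_simps)
    also have "\<dots> = real (Suc n) * (1 - x) * (real (n choose j) * (t - 1) ^ (n - j) * ((1 - x) ^ (n - j) * e j))"
      unfolding b using j by (simp add: Suc_diff_le)
    finally show "real (Suc n choose j) * (real (Suc n - j) * (t - 1) ^ (n - j)) * ((1 - x) ^ (Suc n - j) * e j)
        = real (Suc n) * (1 - x) * (real (n choose j) * (t - 1) ^ (n - j) * ((1 - x) ^ (n - j) * e j))" .
  qed
  finally show ?thesis .
qed

section \<open>Symmetric unimodal coefficients\<close>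

text \<open>The centre is N/2. Indexing by all integers turns the vanishing of coefficients outside
  the range into a case of symmetry and avoids boundary conditions.\<close>

definition sym_unimodal :: "int \<Rightarrow> (int \<Rightarrow> real) \<Rightarrow> bool" where
  "sym_unimodal N f \<longleftrightarrow> (\<forall>j. f (N - j) = f j) \<and> (\<forall>j. 2 * j \<le> N + 1 \<longrightarrow> f (j - 1) \<le> f j)"

text \<open>The hypotheses say that \<open>j\<close> is at least as close to the centre as
  \<open>i\<close>. If \<open>j\<close> is beyond the centre, its mirror image \<open>N - j\<close>
  is still at least \<open>i\<close>.\<close>

lemma sym_unimodal_mono:
  assumes "sym_unimodal N f" "i \<le> j" "i + j \<le> N"
  shows "f i \<le> f j"
proof -
  have up: "f i \<le> f k" if "i \<le> k" "2 * k \<le> N + 1" for k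
    using that
  proof (induction k rule: int_ge_induct)
    case (step k)
    have "f (k + 1 - 1) \<le> f (k + 1)"
      using assms(1) step.prems unfolding sym_unimodal_def by blast
    then show ?case
      using step by simp
  qed simp
  show ?thesis
  proof (cases "2 * j \<le> N + 1")
    case False
    hence "f i \<le> f (N - j)"
      using assms by (intro up) auto
    thus ?thesis
      using assms(1) by (simp add: sym_unimodal_def)
  qed (use up assms in auto)
qed

text \<open>Moving the window by one step changes the sum by \<open>f j - f (j - r)\<close>, and
  \<open>2 * j \<le> N + r\<close> is exactly the condition under which
  \<open>sym_unimodal_mono\<close> compares these two values.\<close>

lemma sym_unimodal_window_sum:
  assumes f: "sym_unimodal N f" and r: "r > 0"
  shows "sym_unimodal (N + int r - 1) (\<lambda>j. \<Sum>i<r. f (j - int i))"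
  unfolding sym_unimodal_def
proof (intro conjI allI impI)
  fix j
  have "(\<Sum>i<r. f (N + int r - 1 - j - int i)) = (\<Sum>i<r. f (N - (j - int (r - Suc i))))"
    by (rule sum.cong) (auto simp: of_nat_diff algebra_simps)
  also have "\<dots> = (\<Sum>i<r. f (j - int (r - Suc i)))"
    using f by (simp add: sym_unimodal_def)
  also have "\<dots> = (\<Sum>i<r. f (j - int i))"
    by (rule sum.nat_diff_reindex)
  finally show "(\<Sum>i<r. f (N + int r - 1 - j - int i)) = (\<Sum>i<r. f (j - int i))" .
next
  fix j assume j: "2 * j \<le> N + int r - 1 + 1"
  have "(\<Sum>i<r. f (j - int i)) + f (j - int r) = (\<Sum>i<Suc r. f (j - int i))"
    by simp
  also have "\<dots> = f j + (\<Sum>i<r. f (j - 1 - int i))"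
    by (subst sum.lessThan_Suc_shift) (simp add: algebra_simps)
  finally show "(\<Sum>i<r. f (j - 1 - int i)) \<le> (\<Sum>i<r. f (j - int i))"
    using sym_unimodal_mono[OF f, of "j - int r" j] j by simp
qed

definition int_coeff :: "real poly \<Rightarrow> int \<Rightarrow> real" where
  "int_coeff p j = (if j < 0 then 0 else coeff p (nat j))"

lemma int_coeff_of_nat [simp]: "int_coeff p (int k) = coeff p k"
  by (simp add: int_coeff_def)

lemma int_coeff_neg: "j < 0 \<Longrightarrow> int_coeff p j = 0"
  by (simp add: int_coeff_def)

definition geom_poly :: "nat \<Rightarrow> real poly" where
  "geom_poly r = (\<Sum>i<r. monom 1 i)"

lemma int_coeff_mult_geom_poly:
  "int_coeff (p * geom_poly r) = (\<lambda>j. \<Sum>i<r. int_coeff p (j - int i))"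
proof
  fix j
  show "int_coeff (p * geom_poly r) j = (\<Sum>i<r. int_coeff p (j - int i))"
  proof (cases "j < 0")
    case False
    then obtain k where "j = int k"
      by (metis nonneg_int_cases not_less)
    thus ?thesis
      by (auto simp: geom_poly_def sum_distrib_left coeff_sum mult.commute[of p] coeff_monom_mult
          int_coeff_def nat_diff_distrib intro!: sum.cong)
  qed (simp add: int_coeff_neg)
qed

lemma int_coeff_eulerian_Suc:
  "int_coeff (eulerian (Suc n)) k =
     (of_int k + 1) * int_coeff (eulerian n) k + (real n + 1 - of_int k) * int_coeff (eulerian n) (k - 1)"
proof (cases "k < 0")
  case False
  then obtain m where "k = int m"
    by (metis nonneg_int_cases not_less)
  show ?thesis
  proof (cases m)
    case 0
    thus ?thesis
      using \<open>k = int m\<close> by (simp add: int_coeff_def eulerian.simps(2))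
  next
    case (Suc l)
    hence k: "k = int (Suc l)" "int (Suc l) - 1 = int l"
      using \<open>k = int m\<close> by auto
    show ?thesis
      unfolding k int_coeff_of_nat by (cases l) (simp_all add: eulerian.simps(2) coeff_pderiv algebra_simps)
  qed
qed (simp add: int_coeff_neg)

text \<open>The recurrence is invariant under reflection. It also writes each increment of the new
  coefficients as a combination of two consecutive increments of the old ones, with nonnegative
  weights where these increments do not vanish.\<close>

lemma sym_unimodal_eulerian: "sym_unimodal (int n) (int_coeff (eulerian (Suc n)))"
proof (induction n)
  case 0
  have "int_coeff [:1:] j = (if j = 0 then 1 else 0)" for j
    by (auto simp: int_coeff_def coeff_pCons split: nat.splits)
  then show ?case
    by (auto simp: sym_unimodal_def eulerian.simps(2))
next
  case (Suc n)
  let ?a = "int_coeff (eulerian (Suc n))"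
  let ?b = "int_coeff (eulerian (Suc (Suc n)))"
  have rec: "?b k = (of_int k + 1) * ?a k + (real n + 2 - of_int k) * ?a (k - 1)" for k
    by (subst int_coeff_eulerian_Suc) simp
  have sym: "?a (int n - j) = ?a j" for j
    using Suc by (simp add: sym_unimodal_def)
  have symb: "?b (int (Suc n) - j) = ?b j" for j
    using sym[of j] sym[of "j - 1"] by (simp add: rec algebra_simps)
  moreover have "?b (j - 1) \<le> ?b j" if j: "2 * j \<le> int (Suc n) + 1" for j
  \<comment> \<open>At the middle the old increments no longer have a known sign, but the two new
    coefficients are mirror images.\<close>
  proof (cases "2 * j = int (Suc n) + 1")
    case True
    hence eq: "int (Suc n) - j = j - 1"
      by simp
    show ?thesis
      using symb[of j] unfolding eq by simp
  next
    case False
    have d1: "0 \<le> ?a j - ?a (j - 1)" and d2: "0 \<le> ?a (j - 1) - ?a (j - 2)"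
      using sym_unimodal_mono[OF Suc, of "j - 1" j] sym_unimodal_mono[OF Suc, of "j - 2" "j - 1"]
        False j by auto
    have "?b j - ?b (j - 1)
        = (of_int j + 1) * (?a j - ?a (j - 1)) + (real n + 3 - of_int j) * (?a (j - 1) - ?a (j - 2))"
      by (simp add: rec algebra_simps)
    moreover have "real_of_int j \<le> real n + 3"
      using j by linarith
    moreover have "(of_int j + 1) * (?a j - ?a (j - 1)) \<ge> 0"
    proof (cases "j < 0")
      case False
      thus ?thesis using d1 by simp
    qed (simp add: int_coeff_neg)
    ultimately show ?thesis
      using d2 by (smt (verit) mult_nonneg_nonneg)
  qed
  ultimately show ?case
    by (auto simp: sym_unimodal_def)
qed

text \<open>The numerator of the series of (m + 1)^n - m^n over the denominator (1 - x^r)^n. Such a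
  denominator is compatible with extracting every r-th coefficient.\<close>

definition refined_eulerian :: "nat \<Rightarrow> nat \<Rightarrow> real poly" where
  "refined_eulerian r n = eulerian n * geom_poly r ^ n"

text \<open>The Eulerian factor is symmetric about (n - 1)/2, and each of the n factors
  \<open>geom_poly r\<close> raises the doubled centre by r - 1.\<close>

lemma sym_unimodal_refined_eulerian:
  assumes "r > 0" "n > 0"
  shows "sym_unimodal (int (r * n) - 1) (int_coeff (refined_eulerian r n))"
proof -
  have "sym_unimodal (int n - 1 + int k * (int r - 1)) (int_coeff (eulerian n * geom_poly r ^ k))" for k
  proof (induction k)
    case 0
    then show ?case
      using sym_unimodal_eulerian[of "n - 1"] assms by (simp add: of_nat_diff)
  next
    case (Suc k)
    have "eulerian n * geom_poly r ^ Suc k = (eulerian n * geom_poly r ^ k) * geom_poly r"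
      by (simp add: ac_simps)
    moreover have "int n - 1 + int (Suc k) * (int r - 1) = int n - 1 + int k * (int r - 1) + int r - 1"
      by (simp add: algebra_simps)
    ultimately show ?case
      using sym_unimodal_window_sum[OF Suc assms(1)] by (simp only: int_coeff_mult_geom_poly)
  qed
  from this[of n] show ?thesis
    by (simp add: refined_eulerian_def algebra_simps)
qed

text \<open>Of the n + 1 factors 1 - x, n turn the geometric sums into 1 - x^r and the last one
  takes differences of consecutive powers.\<close>

lemma fps_of_poly_refined_eulerian:
  assumes "n > 0"
  shows "fps_of_poly (refined_eulerian r n)
      = (1 - fps_X ^ r) ^ n * Abs_fps (\<lambda>m. (real m + 1) ^ n - real m ^ n)"
proof -
  have geom: "(1 - fps_X) * fps_of_poly (geom_poly r) = (1 - fps_X ^ r :: real fps)"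
    by (simp add: geom_poly_def fps_of_poly_sum fps_of_poly_monom' one_diff_power_eq)
  have diff: "(1 - fps_X) * Abs_fps (\<lambda>m. (real m + 1) ^ n) = Abs_fps (\<lambda>m. (real m + 1) ^ n - real m ^ n)"
    by (rule fps_ext) (use assms in \<open>auto simp: left_diff_distrib fps_X_mult_nth\<close>)
  have "fps_of_poly (refined_eulerian r n)
      = ((1 - fps_X) * fps_of_poly (geom_poly r)) ^ n * ((1 - fps_X) * Abs_fps (\<lambda>m. (real m + 1) ^ n))"
    by (simp add: refined_eulerian_def fps_of_poly_mult fps_of_poly_power fps_of_poly_eulerian
        power_mult_distrib ac_simps)
  thus ?thesis
    unfolding geom diff .
qed

text \<open>Multiplication by 1 - x^r respects residue classes of indices modulo r and acts on each
  of them as multiplication by 1 - x.\<close>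

lemma section_one_minus_X_power:
  fixes F :: "real fps"
  assumes "a < r"
  shows "((1 - fps_X ^ r) ^ n * F) $ (r * k + a) = ((1 - fps_X) ^ n * Abs_fps (\<lambda>k. F $ (r * k + a))) $ k"
proof -
  have one: "Abs_fps (\<lambda>k. ((1 - fps_X ^ r) * G) $ (r * k + a)) = (1 - fps_X) * Abs_fps (\<lambda>k. G $ (r * k + a))"
    for G :: "real fps"
  proof (rule fps_ext)
    fix k
    show "Abs_fps (\<lambda>k. ((1 - fps_X ^ r) * G) $ (r * k + a)) $ k
        = ((1 - fps_X) * Abs_fps (\<lambda>k. G $ (r * k + a))) $ k"
      using assms
      by (cases k) (auto simp: left_diff_distrib fps_X_power_mult_nth fps_X_mult_nth)
  qed
  have "Abs_fps (\<lambda>k. ((1 - fps_X ^ r) ^ n * F) $ (r * k + a)) = (1 - fps_X) ^ n * Abs_fps (\<lambda>k. F $ (r * k + a))"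
  proof (induction n)
    case (Suc n)
    then show ?case
      using one[of "(1 - fps_X ^ r) ^ n * F"] by (simp add: mult.assoc)
  qed simp
  from arg_cong[OF this, of "\<lambda>f. f $ k"] show ?thesis by simp
qed

text \<open>The residue \<open>a = 0\<close> will give the colored polynomial and
  \<open>a = r - 1\<close> its reversal.\<close>

lemma coeff_refined_eulerian:
  assumes "a < r" "n > 0"
  shows "coeff (refined_eulerian r n) (r * k + a)
      = ((1 - fps_X) ^ n * Abs_fps (\<lambda>m. (real r * real m + real a + 1) ^ n - (real r * real m + real a) ^ n)) $ k"
proof -
  have "coeff (refined_eulerian r n) (r * k + a) = fps_of_poly (refined_eulerian r n) $ (r * k + a)"
    by simp
  thus ?thesis
    unfolding fps_of_poly_refined_eulerian[OF assms(2)] section_one_minus_X_power[OF assms(1)] by simp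
qed

section \<open>Coefficients of the colored polynomial and of its reversal\<close>

lemma fps_of_poly_colored_eulerian_plus:
  "fps_of_poly (colored_eulerian_plus r n)
     = (1 - fps_X) ^ n * Abs_fps (\<lambda>m. (real r * real m + 1) ^ n - (real r * real m) ^ n)"
proof -
  let ?Y = "(1 - fps_X :: real fps) ^ n"
  have unit: "?Y $ 0 \<noteq> 0"
    by simp
  have "Abs_fps (\<lambda>m. (real r * real m + 1) ^ n - (real r * real m) ^ n)
      = fps_of_poly (colored_eulerian_plus r n) / ?Y"
    unfolding colored_eulerian_plus_def by (rule theI'[OF colored_eulerian_plus_ex1])
  thus ?thesis
    using inverse_mult_eq_1'[OF unit] by (simp add: fps_divide_unit[OF unit] mult.left_commute)
qed

lemma coeff_colored_eulerian_plus:
  assumes "r > 0" "n > 0"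
  shows "coeff (colored_eulerian_plus r n) k = int_coeff (refined_eulerian r n) (int (r * k))"
  using coeff_refined_eulerian[OF assms, of k]
  by (simp flip: fps_of_poly_nth add: fps_of_poly_colored_eulerian_plus del: fps_of_poly_nth of_nat_mult)

lemma
  assumes "r > 0" "n > 0"
  shows coeff_0_colored_eulerian_plus: "coeff (colored_eulerian_plus r n) 0 = 1"
    and degree_colored_eulerian_plus: "degree (colored_eulerian_plus r n) = n - 1"
    and lead_coeff_colored_eulerian_plus: "lead_coeff (colored_eulerian_plus r n) > 0"
proof -
  let ?A = "colored_eulerian_plus r n"
  let ?c = "int_coeff (refined_eulerian r n)"
  have U: "sym_unimodal (int (r * n) - 1) ?c"
    by (rule sym_unimodal_refined_eulerian[OF assms])
  have sym: "?c (int (r * n) - 1 - j) = ?c j" for j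
    using U by (simp add: sym_unimodal_def)
  show c0: "coeff ?A 0 = 1"
    using assms by (simp flip: fps_of_poly_nth add: fps_of_poly_colored_eulerian_plus fps_nth_power_0 power_0_left del: fps_of_poly_nth)
  \<comment> \<open>Reflection exchanges the indices r(n - 1) and r - 1.\<close>
  have "coeff ?A (n - 1) = ?c (int r - 1)"
    using sym[of "int r - 1"] assms
    by (simp add: coeff_colored_eulerian_plus of_nat_diff algebra_simps)
  also have "\<dots> \<ge> ?c 0"
  proof (rule sym_unimodal_mono[OF U])
    have "r \<le> r * n"
      using mult_le_mono2[of 1 n r] assms by simp
    thus "0 + (int r - 1) \<le> int (r * n) - 1"
      by linarith
  qed (use assms in simp)
  finally have top: "coeff ?A (n - 1) \<ge> 1"
    using c0 coeff_colored_eulerian_plus[OF assms, of 0] by simp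
  have "degree ?A \<le> n - 1"
  proof (rule degree_le, intro allI impI)
    fix k assume "n - 1 < k"
    hence "r * n \<le> r * k"
      by (intro mult_left_mono) auto
    \<comment> \<open>For k >= n the mirror image of the index r k is negative.\<close>
    hence "?c (int (r * n) - 1 - int (r * k)) = 0"
      by (intro int_coeff_neg) linarith
    thus "coeff ?A k = 0"
      using sym[of "int (r * k)"] by (simp only: coeff_colored_eulerian_plus[OF assms])
  qed
  moreover have "n - 1 \<le> degree ?A"
    using top by (intro le_degree) auto
  ultimately show deg: "degree ?A = n - 1"
    by simp
  show "lead_coeff ?A > 0"
    using top deg by simp
qed

text \<open>After reflection, the coefficients with indices i, n - 1 - i and i + 1 are the refined
  ones at r i, r i + r - 1 and r(i + 1). The chain thus walks towards the centre, and the bounds on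
  i are what \<open>sym_unimodal_mono\<close> asks for.\<close>

lemma alternatingly_increasing_colored_eulerian_plus:
  assumes "r > 0" "n > 0"
  shows "alternatingly_increasing (colored_eulerian_plus r n)"
proof -
  let ?A = "colored_eulerian_plus r n"
  let ?c = "int_coeff (refined_eulerian r n)"
  have U: "sym_unimodal (int (r * n) - 1) ?c"
    by (rule sym_unimodal_refined_eulerian[OF assms])
  have flip: "coeff ?A (n - 1 - i) = ?c (int (r * i + r) - 1)" if "i \<le> n - 1" for i
  proof -
    have eq: "int (r * (n - 1 - i)) = int (r * n) - 1 - (int (r * i + r) - 1)"
    proof -
      define l where "l = n - 1 - i"
      have "n = l + (i + 1)"
        unfolding l_def using that assms by linarith
      hence "r * n = r * l + (r * i + r)"
        by (simp add: algebra_simps)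
      thus ?thesis
        unfolding l_def[symmetric] by simp
    qed
    show ?thesis
      using U unfolding coeff_colored_eulerian_plus[OF assms] eq sym_unimodal_def by blast
  qed
  show ?thesis
    unfolding alternatingly_increasing_def degree_colored_eulerian_plus[OF assms]
      coeff_0_colored_eulerian_plus[OF assms]
  proof (intro conjI allI impI)
    fix i assume i: "2 * i \<le> n - 1"
    hence "r * (2 * i + 1) \<le> r * n"
      using assms by (intro mult_le_mono2) linarith
    hence "r * i + (r * i + r) \<le> r * n"
      by (simp add: algebra_simps)
    hence "int (r * i) + (int (r * i + r) - 1) \<le> int (r * n) - 1"
      by linarith
    hence "?c (int (r * i)) \<le> ?c (int (r * i + r) - 1)"
      using assms by (intro sym_unimodal_mono[OF U]) auto
    thus "coeff ?A i \<le> coeff ?A (n - 1 - i)"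
      using i flip[of i] by (simp only: coeff_colored_eulerian_plus[OF assms])
  next
    fix i assume i: "2 * i < n - 1"
    hence "r * (2 * i + 2) \<le> r * n"
      by (intro mult_le_mono2) linarith
    hence "(r * i + r) + r * (i + 1) \<le> r * n"
      by (simp add: algebra_simps)
    hence "(int (r * i + r) - 1) + int (r * (i + 1)) \<le> int (r * n) - 1"
      by linarith
    hence "?c (int (r * i + r) - 1) \<le> ?c (int (r * (i + 1)))"
      by (intro sym_unimodal_mono[OF U]) (auto simp: algebra_simps)
    thus "coeff ?A (n - 1 - i) \<le> coeff ?A (i + 1)"
      using i flip[of i] by (simp only: coeff_colored_eulerian_plus[OF assms])
  qed simp
qed

text \<open>Reflection sends r(n - 1 - k) to r k + (r - 1), so the reversal collects the refined
  coefficients of residue r - 1.\<close>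

lemma fps_of_poly_reversal_colored_eulerian_plus:
  assumes "r > 0" "n > 0"
  shows "fps_of_poly (reversal (n - 1) (colored_eulerian_plus r n))
     = (1 - fps_X) ^ n * Abs_fps (\<lambda>m. (real r * real m + real r) ^ n - (real r * real m + (real r - 1)) ^ n)"
proof (rule fps_ext)
  fix k
  let ?A = "colored_eulerian_plus r n"
  let ?c = "int_coeff (refined_eulerian r n)"
  have sym: "?c (int (r * n) - 1 - j) = ?c j" for j
    using sym_unimodal_refined_eulerian[OF assms] by (simp add: sym_unimodal_def)
  have "coeff (reversal (n - 1) ?A) k = ?c (int (r * k + (r - 1)))"
  proof (cases "k \<le> n - 1")
    case True
    define l where "l = n - 1 - k"
    have "n = l + (k + 1)"
      unfolding l_def using True assms by linarith
    hence "r * n = r * l + (r * k + (r - 1)) + 1"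
      using assms by (simp add: algebra_simps)
    hence "int (r * (n - 1 - k)) = int (r * n) - 1 - int (r * k + (r - 1))"
      unfolding l_def[symmetric] by simp
    thus ?thesis
      using True sym degree_colored_eulerian_plus[OF assms]
      by (simp add: reversal_def coeff_reflect_poly coeff_colored_eulerian_plus[OF assms]
          del: of_nat_mult of_nat_add)
  next
    case False
    hence "r * n \<le> r * k"
      by (intro mult_left_mono) auto
    hence "?c (int (r * n) - 1 - int (r * k + (r - 1))) = 0"
      by (intro int_coeff_neg) linarith
    thus ?thesis
      using False sym degree_colored_eulerian_plus[OF assms]
      by (simp add: reversal_def coeff_reflect_poly del: of_nat_mult of_nat_add)
  qed
  moreover have shift: "real r * real m + real (r - 1) + 1 = real r * real m + real r"
    "real (r - 1) = real r - 1" for m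
    using assms by (simp_all add: of_nat_diff)
  ultimately show "fps_of_poly (reversal (n - 1) ?A) $ k = ((1 - fps_X) ^ n *
      Abs_fps (\<lambda>m. (real r * real m + real r) ^ n - (real r * real m + (real r - 1)) ^ n)) $ k"
    using coeff_refined_eulerian[of "r - 1" r n k] assms
    by (simp only: fps_of_poly_nth int_coeff_of_nat shift)
qed

text \<open>Pull r^n out of the powers. The factor 1 - x makes up for the exponent n + 1 in the
  normalisation of \<open>shifted_eulerian\<close>.\<close>

lemma shifted_eulerian_diff:
  assumes "r > 0" "fps_of_poly p = (1 - fps_X) ^ n *
      Abs_fps (\<lambda>m. (real r * real m + s) ^ n - (real r * real m + t) ^ n)"
  shows "[:1, -1:] * p = smult (real r ^ n) (shifted_eulerian n (s / real r) - shifted_eulerian n (t / real r))"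
proof -
  have pow: "(real r * real m + u) ^ n = real r ^ n * (real m + u / real r) ^ n" for m u
    using assms(1) by (simp add: field_simps flip: power_mult_distrib)
  have "Abs_fps (\<lambda>m. (real r * real m + s) ^ n - (real r * real m + t) ^ n)
     = fps_const (real r ^ n) * (Abs_fps (\<lambda>m. (real m + s / real r) ^ n) - Abs_fps (\<lambda>m. (real m + t / real r) ^ n))"
    by (rule fps_ext) (simp add: pow right_diff_distrib)
  hence "fps_of_poly ([:1, -1:] * p)
    = fps_of_poly (smult (real r ^ n) (shifted_eulerian n (s / real r) - shifted_eulerian n (t / real r)))"
    by (simp only: fps_of_poly_mult fps_of_poly_smult fps_of_poly_diff fps_of_poly_one_minus_X
        fps_of_poly_shifted_eulerian assms(2)) (simp add: algebra_simps)
  thus ?thesis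
    by (simp only: fps_of_poly_eq_iff)
qed

section \<open>Zeros in the shift parameter\<close>

text \<open>The interval is half-open because under f(0) = x f(1) a zero at 0 always comes with one
  at 1.\<close>

definition at_most_one_zero :: "(real \<Rightarrow> real) \<Rightarrow> bool" where
  "at_most_one_zero f \<longleftrightarrow> (\<forall>s t. 0 \<le> s \<longrightarrow> s < t \<longrightarrow> t < 1 \<longrightarrow> f s = 0 \<longrightarrow> f t \<noteq> 0)"

lemma continuous_opposite_signs_zero:
  fixes f :: "real \<Rightarrow> real"
  assumes "a \<le> b" "continuous_on UNIV f" "f a * f b \<le> 0"
  obtains c where "a \<le> c" "c \<le> b" "f c = 0"
proof -
  have cont: "continuous_on {a..b} f"
    using assms(2) continuous_on_subset by blast
  consider "f a \<le> 0" "0 \<le> f b" | "f b \<le> 0" "0 \<le> f a"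
    using assms(3) by (auto simp: mult_le_0_iff)
  thus ?thesis
    using IVT'[of f a 0 b] IVT2'[of f b 0 a] assms(1) cont that by cases blast+
qed

text \<open>Models two consecutive shifted Eulerian polynomials as functions of t for fixed x < 0.
  The boundary conditions resemble antiperiodicity, with the negative factor x in place of
  -1.\<close>

locale antiperiodic_primitive =
  fixes f g :: "real \<Rightarrow> real" and c x :: real
  assumes deriv: "\<And>t. (f has_field_derivative c * g t) (at t)"
    and cont: "continuous_on UNIV g"
    and c_pos: "c > 0" and x_neg: "x < 0"
    and f_0: "f 0 = x * f 1" and g_0: "g 0 = x * g 1"
    and at_most_one_zero_g: "at_most_one_zero g"
begin

lemma mvt:
  assumes "a < b"
  obtains \<xi> where "a < \<xi>" "\<xi> < b" "f b - f a = (b - a) * (c * g \<xi>)"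
  using MVT2[OF assms, of f "\<lambda>t. c * g t"] deriv by blast

lemma at_most_one_zeroD: "0 \<le> s \<Longrightarrow> s < 1 \<Longrightarrow> 0 \<le> t \<Longrightarrow> t < 1 \<Longrightarrow> g s = 0 \<Longrightarrow> g t = 0 \<Longrightarrow> s = t"
  using at_most_one_zero_g unfolding at_most_one_zero_def by (cases s t rule: linorder_cases) blast+

lemma zero_between:
  assumes "a \<le> b" "g a * g b \<le> 0"
  obtains v where "a \<le> v" "v \<le> b" "g v = 0"
  using continuous_opposite_signs_zero[OF assms(1) cont assms(2)] by blast

lemma rolle:
  assumes "a < b" "f a = f b"
  obtains u where "a < u" "u < b" "g u = 0"
  using mvt[OF assms(1)] assms c_pos by (metis diff_self less_irrefl mult_eq_0_iff right_minus_eq)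

text \<open>Two zeros s < t of f enclose a zero of g, the only one in [0, 1). The mean value theorem
  on [0, s] and [t, 1] with f(0) = x f(1) gives g the same sign at points of both intervals. As g
  has no further zero, g(0) and g(1) then agree in sign, against g(0) = x g(1).\<close>

lemma at_most_one_zero_primitive: "at_most_one_zero f"
  unfolding at_most_one_zero_def
proof (intro allI impI notI)
  fix s t assume st: "0 \<le> s" "s < t" "t < 1" "f s = 0" "f t = 0"
  obtain u where u: "s < u" "u < t" "g u = 0"
    using rolle[of s t] st by auto
  obtain \<xi> where \<xi>: "t < \<xi>" "\<xi> < 1" "f 1 - f t = (1 - t) * (c * g \<xi>)"
    using mvt st by blast
  have g\<xi>: "g \<xi> \<noteq> 0"
    using at_most_one_zeroD[of u \<xi>] u \<xi> st by auto
  have f1: "f 1 = (1 - t) * c * g \<xi>"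
    using \<xi> st by simp
  \<comment> \<open>This excludes s = 0, so that the mean value theorem applies on [0, s].\<close>
  have "f 0 \<noteq> 0"
    using f_0 f1 g\<xi> x_neg c_pos st by simp
  hence "0 < s"
    using st by (cases "s = 0") auto
  then obtain \<eta> where \<eta>: "0 < \<eta>" "\<eta> < s" "f s - f 0 = (s - 0) * (c * g \<eta>)"
    using mvt by blast
  have "- (s * c * g \<eta>) = x * ((1 - t) * c * g \<xi>)"
    using \<eta> st f_0 f1 by simp
  hence "c * (s * g \<eta>) = c * ((- x) * (1 - t) * g \<xi>)"
    by (simp add: algebra_simps)
  hence "s * g \<eta> = (- x) * (1 - t) * g \<xi>"
    using c_pos by (metis less_irrefl mult_left_cancel)
  hence same: "s * (g \<eta> * g \<xi>) = (- x) * (1 - t) * (g \<xi> * g \<xi>)"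
    by (metis mult.assoc)
  have "(- x) * (1 - t) * (g \<xi> * g \<xi>) > 0"
  proof (rule mult_pos_pos)
    show "g \<xi> * g \<xi> > 0"
      using g\<xi> not_real_square_gt_zero by blast
  qed (use x_neg st in \<open>intro mult_pos_pos, auto\<close>)
  hence pos: "g \<eta> * g \<xi> > 0"
    using same \<open>0 < s\<close> by (metis zero_less_mult_pos)
  have n1: "g 0 * g \<eta> > 0"
  proof (rule ccontr)
    assume "\<not> ?thesis"
    then obtain v where "0 \<le> v" "v \<le> \<eta>" "g v = 0"
      using zero_between[of 0 \<eta>] \<eta> by auto
    thus False
      using at_most_one_zeroD[of v u] u \<eta> st by auto
  qed
  hence "g 1 \<noteq> 0"
    using g_0 by auto
  have n2: "g \<xi> * g 1 > 0"
  proof (rule ccontr)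
    assume "\<not> ?thesis"
    then obtain v where "\<xi> \<le> v" "v \<le> 1" "g v = 0"
      using zero_between[of \<xi> 1] \<xi> by auto
    thus False
      using at_most_one_zeroD[of v u] u \<xi> st \<open>g 1 \<noteq> 0\<close> by (cases "v = 1") auto
  qed
  have "g 0 * g 1 < 0"
    using mult_neg_pos[OF x_neg, of "g 1 * g 1"] g_0 \<open>g 1 \<noteq> 0\<close> not_real_square_gt_zero[of "g 1"]
    by (metis mult.assoc)
  thus False
    using pos n1 n2 by (auto simp: zero_less_mult_iff mult_less_0_iff)
qed

text \<open>Here f vanishes at 0 and 1. If f(t) did not have the sign of g(0), the mean value
  theorem would give g one zero before t and another between t and 1.\<close>

lemma sign_between_zeros:
  assumes "f 1 = 0" "g 0 \<noteq> 0" "0 < t" "t < 1"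
  shows "0 < f t * g 0"
proof (rule ccontr)
  assume neg: "\<not> ?thesis"
  have f0: "f 0 = 0"
    using f_0 assms by simp
  obtain \<xi> where \<xi>: "0 < \<xi>" "\<xi> < t" "f t - f 0 = (t - 0) * (c * g \<xi>)"
    using mvt assms by blast
  obtain \<eta> where \<eta>: "t < \<eta>" "\<eta> < 1" "f 1 - f t = (1 - t) * (c * g \<eta>)"
    using mvt assms by blast
  have "t * c * (g 0 * g \<xi>) \<le> 0"
    using neg \<xi> f0 by (simp add: algebra_simps)
  hence "g 0 * g \<xi> \<le> 0"
    using assms c_pos by (simp add: mult_le_0_iff zero_less_mult_iff)
  then obtain v where v: "0 \<le> v" "v \<le> \<xi>" "g v = 0"
    using zero_between[of 0 \<xi>] \<xi> by auto
  have "(1 - t) * c * (g \<eta> * g 0) \<ge> 0"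
  proof -
    have "(1 - t) * c * (g \<eta> * g 0) = - (f t * g 0)"
      using \<eta> assms by (simp add: algebra_simps)
    thus ?thesis using neg by simp
  qed
  moreover have "(1 - t) * c > 0"
    using assms c_pos by simp
  ultimately have "g \<eta> * g 0 \<ge> 0"
    using mult_pos_neg[of "(1 - t) * c" "g \<eta> * g 0"] by linarith
  moreover have "g 1 \<noteq> 0"
    using g_0 assms by auto
  ultimately have "g \<eta> * g 1 \<le> 0"
    using g_0 x_neg by (auto simp: zero_le_mult_iff mult_le_0_iff)
  then obtain w where w: "\<eta> \<le> w" "w \<le> 1" "g w = 0"
    using zero_between[of \<eta> 1] \<eta> by auto
  have "w \<noteq> 1"
    using w \<open>g 1 \<noteq> 0\<close> by auto
  thus False
    using at_most_one_zeroD[of v w] v w \<xi> \<eta> by auto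
qed

text \<open>Rolle gives a zero of g in (0, h). Since f(1) - f(h) has the sign opposite to f(0), any
  other behaviour of f(1) - f(1 - h) would produce a second zero of g in (h, 1).\<close>

lemma sign_after_turning:
  assumes "f h = f 0" "f 0 \<noteq> 0" "0 < h" "h \<le> 1 - h"
  shows "(f 1 - f (1 - h)) * f 0 < 0"
proof (rule ccontr)
  assume neg: "\<not> ?thesis"
  obtain u where u: "0 < u" "u < h" "g u = 0"
    using rolle[of 0 h] assms by auto
  have f1: "(f 1 - f 0) * f 0 < 0"
  proof -
    have "f 1 \<noteq> 0"
      using f_0 assms by auto
    hence "f 1 * f 0 < 0"
      using mult_neg_pos[OF x_neg, of "f 1 * f 1"] f_0 not_real_square_gt_zero[of "f 1"]
      by (metis mult.commute mult.assoc)
    moreover have "f 0 * f 0 > 0"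
      using assms not_real_square_gt_zero by blast
    ultimately show ?thesis
      by (simp add: left_diff_distrib)
  qed
  obtain \<xi> where \<xi>: "h < \<xi>" "\<xi> < 1" "f 1 - f h = (1 - h) * (c * g \<xi>)"
    using mvt[of h 1] assms by auto
  obtain \<eta> where \<eta>: "1 - h < \<eta>" "\<eta> < 1" "f 1 - f (1 - h) = (1 - (1 - h)) * (c * g \<eta>)"
    using mvt[of "1 - h" 1] assms by auto
  have "(1 - h) * c * (g \<xi> * f 0) < 0"
    using \<xi> f1 assms(1) by (simp add: ac_simps)
  hence s1: "g \<xi> * f 0 < 0"
    using assms c_pos by (simp add: mult_less_0_iff zero_less_mult_iff)
  have "h * c * (g \<eta> * f 0) \<ge> 0"
    using \<eta> neg by (simp add: ac_simps)
  moreover have "h * c > 0"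
    using assms c_pos by simp
  ultimately have s2: "g \<eta> * f 0 \<ge> 0"
    using mult_pos_neg[of "h * c" "g \<eta> * f 0"] by linarith
  have "g \<xi> * g \<eta> \<le> 0"
    using s1 s2 by (auto simp: mult_less_0_iff zero_le_mult_iff mult_le_0_iff)
  \<comment> \<open>The order of \<open>\<xi>\<close> and \<open>\<eta>\<close> is unknown, but both
    lie in (h, 1), the latter because \<open>h \<le> 1 - h\<close>.\<close>
  then obtain v where "h < v" "v < 1" "g v = 0"
  proof (cases "\<xi> \<le> \<eta>")
    case True
    from zero_between[OF this \<open>g \<xi> * g \<eta> \<le> 0\<close>] obtain v
      where "\<xi> \<le> v" "v \<le> \<eta>" "g v = 0" .
    thus ?thesis
      using \<xi> \<eta> by (intro that[of v]) auto
  next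
    case False
    hence "\<eta> \<le> \<xi>" "g \<eta> * g \<xi> \<le> 0"
      using \<open>g \<xi> * g \<eta> \<le> 0\<close> by (auto simp: mult.commute)
    from zero_between[OF this] obtain v where "\<eta> \<le> v" "v \<le> \<xi>" "g v = 0" .
    thus ?thesis
      using \<xi> \<eta> assms by (intro that[of v]) auto
  qed
  thus False
    using at_most_one_zeroD[of u v] u \<xi> \<eta> assms by auto
qed

end

section \<open>Shifted Eulerian polynomials as functions of the shift\<close>

lemma antiperiodic_primitive_shifted_eulerian:
  assumes "x < 0" "n > 0"
    and "at_most_one_zero (\<lambda>t. poly (shifted_eulerian n t) x)"
  shows "antiperiodic_primitive (\<lambda>t. poly (shifted_eulerian (Suc n) t) x)
           (\<lambda>t. poly (shifted_eulerian n t) x) (real (Suc n) * (1 - x)) x"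
proof
  obtain m where n: "n = Suc m"
    using assms(2) gr0_implies_Suc by blast
  show "continuous_on UNIV (\<lambda>t. poly (shifted_eulerian n t) x)"
    unfolding n by (intro continuous_at_imp_continuous_on ballI
        DERIV_isCont[OF has_field_derivative_shifted_eulerian])
qed (use assms has_field_derivative_shifted_eulerian in
      \<open>auto simp: shifted_eulerian_0 shifted_eulerian_1 simp del: of_nat_Suc\<close>)

text \<open>For n = 1 the function is linear in t with slope 1 - x > 0; the locale supplies the
  induction step.\<close>

lemma at_most_one_zero_shifted_eulerian:
  assumes "x < 0" "n > 0"
  shows "at_most_one_zero (\<lambda>t. poly (shifted_eulerian n t) x)"
  using assms(2)
proof (induction n rule: nat_induct_non_zero)
  case 1
  have "poly (shifted_eulerian 1 t) x = (t - 1) * (1 - x) + 1" for t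
    by (simp add: shifted_eulerian_def eulerian.simps algebra_simps)
  hence "poly (shifted_eulerian 1 t) x - poly (shifted_eulerian 1 s) x = (t - s) * (1 - x)" for s t
    by (simp add: algebra_simps)
  then show ?case
    using assms(1) unfolding at_most_one_zero_def
    by (metis diff_0_right diff_gt_0_iff_gt diff_self less_irrefl mult_eq_0_iff right_minus_eq
        zero_less_one less_trans)
next
  case (Suc n)
  then interpret antiperiodic_primitive "\<lambda>t. poly (shifted_eulerian (Suc n) t) x"
    "\<lambda>t. poly (shifted_eulerian n t) x" "real (Suc n) * (1 - x)" x
    using assms(1) by (intro antiperiodic_primitive_shifted_eulerian)
  show ?case
    by (rule at_most_one_zero_primitive)
qed

lemma eulerian_antiperiodic_primitive:
  assumes "x < 0" "n > 0"
  shows "antiperiodic_primitive (\<lambda>t. poly (shifted_eulerian (Suc n) t) x)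
           (\<lambda>t. poly (shifted_eulerian n t) x) (real (Suc n) * (1 - x)) x"
  by (intro antiperiodic_primitive_shifted_eulerian at_most_one_zero_shifted_eulerian assms)

text \<open>At such an x the function of t vanishes at both ends 0 and 1, and g(0) is x times the
  Eulerian value, which turns the sign.\<close>

lemma shifted_eulerian_sign_at_root:
  assumes "x < 0" "n > 0" "poly (eulerian (Suc n)) x = 0" "poly (eulerian n) x \<noteq> 0"
    and "0 < t" "t < 1"
  shows "poly (shifted_eulerian (Suc n) t) x * poly (eulerian n) x < 0"
proof -
  interpret antiperiodic_primitive "\<lambda>t. poly (shifted_eulerian (Suc n) t) x"
    "\<lambda>t. poly (shifted_eulerian n t) x" "real (Suc n) * (1 - x)" x
    using assms by (intro eulerian_antiperiodic_primitive)
  have "0 < poly (shifted_eulerian (Suc n) t) x * (x * poly (eulerian n) x)"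
    using sign_between_zeros[of t] assms
    by (simp add: shifted_eulerian_1 shifted_eulerian_0)
  thus ?thesis
    using assms(1) by (simp add: zero_less_mult_iff mult_less_0_iff)
qed

text \<open>With h = 1/r the equation says that x is a zero of the colored polynomial, and the
  conclusion compares the sign of its reversal with that of the Eulerian polynomial.\<close>

lemma shifted_eulerian_sign_after_turning:
  assumes "x < 0" "n > 0" "poly (shifted_eulerian (Suc n) h) x = poly (shifted_eulerian (Suc n) 0) x"
    and "poly (eulerian (Suc n)) x \<noteq> 0" "0 < h" "h \<le> 1 - h"
  shows "0 < (poly (shifted_eulerian (Suc n) 1) x - poly (shifted_eulerian (Suc n) (1 - h)) x)
     * poly (eulerian (Suc n)) x"
proof -
  interpret antiperiodic_primitive "\<lambda>t. poly (shifted_eulerian (Suc n) t) x"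
    "\<lambda>t. poly (shifted_eulerian n t) x" "real (Suc n) * (1 - x)" x
    using assms by (intro eulerian_antiperiodic_primitive)
  have "(poly (shifted_eulerian (Suc n) 1) x - poly (shifted_eulerian (Suc n) (1 - h)) x)
      * (x * poly (eulerian (Suc n)) x) < 0"
    using sign_after_turning[of h] assms
    by (simp add: shifted_eulerian_0)
  thus ?thesis
    using assms(1) by (simp add: zero_less_mult_iff mult_less_0_iff)
qed

section \<open>Interlacing\<close>

lemma coeff_0_eulerian: "coeff (eulerian n) 0 = 1"
  by (induction n) (simp_all add: eulerian.simps(2))

text \<open>Symmetry carries the constant term 1 to index n and the zeros at negative indices to
  those above n.\<close>

lemma
  shows degree_eulerian: "degree (eulerian (Suc n)) = n"
    and lead_coeff_eulerian: "lead_coeff (eulerian (Suc n)) = 1"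
proof -
  let ?a = "int_coeff (eulerian (Suc n))"
  have sym: "?a (int n - j) = ?a j" for j
    using sym_unimodal_eulerian[of n] by (simp add: sym_unimodal_def)
  have top: "coeff (eulerian (Suc n)) n = 1"
    using sym[of "int n"] coeff_0_eulerian[of "Suc n"] int_coeff_of_nat[of _ 0]
    by (simp del: int_coeff_of_nat add: int_coeff_def)
  have "degree (eulerian (Suc n)) \<le> n"
  proof (rule degree_le, intro allI impI)
    fix k assume "n < k"
    thus "coeff (eulerian (Suc n)) k = 0"
      using sym[of "int k"] by (simp add: int_coeff_neg)
  qed
  thus deg: "degree (eulerian (Suc n)) = n"
    using top by (intro antisym le_degree) auto
  show "lead_coeff (eulerian (Suc n)) = 1"
    using top deg by simp
qed

text \<open>At a zero y of one Eulerian polynomial the recurrence gives the next one the value y(1 -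
  y) times the derivative, which alternates in sign along the zeros. With the value 1 at the origin
  this suffices for all zeros of the next polynomial. The last conclusion records the interlacing as
  signs.\<close>

lemma eulerian_roots:
  obtains y where "desc_roots (eulerian (Suc n)) n y" "\<And>i. i < n \<Longrightarrow> y i < 0"
    "\<And>i. i < n \<Longrightarrow> 0 < (-1) ^ i * poly (eulerian n) (y i)"
proof -
  have "\<exists>y. desc_roots (eulerian (Suc n)) n y \<and> (\<forall>i<n. y i < 0)
      \<and> (\<forall>i<n. 0 < (-1) ^ i * poly (eulerian n) (y i))"
  proof (induction n)
    case 0
    then show ?case
      by (auto simp: eulerian.simps(2) desc_roots_def intro!: exI[of _ 1])
  next
    case (Suc n)
    then obtain y where y: "desc_roots (eulerian (Suc n)) n y" "\<And>i. i < n \<Longrightarrow> y i < 0"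
      by blast
    define x where "x = case_nat 0 y"
    have x_less: "x (Suc i) < x i" if "Suc i < Suc n" for i
      using that y(2) desc_roots_less[OF y(1)] by (cases i) (auto simp: x_def)
    have sgn: "0 < (-1) ^ i * poly (eulerian (Suc (Suc n))) (x i)" if "i < Suc n" for i
    proof (cases i)
      case 0
      thus ?thesis
        by (simp add: x_def poly_0_coeff_0 coeff_0_eulerian)
    next
      case (Suc k)
      hence k: "k < n"
        using that by simp
      have "(-1) ^ i * poly (eulerian (Suc (Suc n))) (x i)
          = (- (y k) * (1 - y k)) * ((-1) ^ k * poly (pderiv (eulerian (Suc n))) (y k))"
        using Suc desc_roots_root[OF y(1) k]
        by (simp add: x_def eulerian.simps(2)[of "Suc n"] algebra_simps)
      also have "\<dots> > 0"
        by (rule mult_pos_pos[OF mult_pos_pos desc_roots_sign_pderiv[OF y(1) k]])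
           (use y(2)[OF k] in auto)
      finally show ?thesis .
    qed
    obtain w where w: "desc_roots (eulerian (Suc (Suc n))) (Suc n) w"
      "\<And>i. i < Suc n \<Longrightarrow> w i < x i" "\<And>i. Suc i < Suc n \<Longrightarrow> x (Suc i) < w i"
    proof (rule desc_roots_of_sign_changes[OF degree_eulerian _ x_less sgn])
    qed (simp_all add: lead_coeff_eulerian)
    have "w i < 0" if "i < Suc n" for i
      using w(2)[OF that] y(2)[of "i - 1"] that by (cases i) (auto simp: x_def)
    \<comment> \<open>Exactly \<open>i\<close> of the old zeros lie to the right of
      \<open>w i\<close>.\<close>
    moreover have "0 < (-1) ^ i * poly (eulerian (Suc n)) (w i)" if "i < Suc n" for i
    proof (rule desc_roots_sign_between[OF y(1)])
      show "w i < y (i - 1)" if "i > 0"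
        using w(2)[OF \<open>i < Suc n\<close>] that by (cases i) (auto simp: x_def)
      show "y i < w i" if "i < n"
        using w(3)[of i] that by (simp add: x_def)
    qed (use that in simp)
    ultimately show ?case
      using w(1) by blast
  qed
  thus ?thesis
    using that by blast
qed

lemma poly_colored_eulerian_plus:
  assumes "r > 0"
  shows "(1 - x) * poly (colored_eulerian_plus r n) x
    = real r ^ n * (poly (shifted_eulerian n (1 / real r)) x - poly (shifted_eulerian n 0) x)"
proof -
  have "[:1, -1:] * colored_eulerian_plus r n
      = smult (real r ^ n) (shifted_eulerian n (1 / real r) - shifted_eulerian n (0 / real r))"
    by (rule shifted_eulerian_diff[OF assms]) (simp add: fps_of_poly_colored_eulerian_plus)
  from arg_cong[OF this, of "\<lambda>p. poly p x"] show ?thesis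
    by (simp add: algebra_simps)
qed

lemma poly_reversal_colored_eulerian_plus:
  assumes "r > 0" "n > 0"
  shows "(1 - x) * poly (reversal (n - 1) (colored_eulerian_plus r n)) x
    = real r ^ n * (poly (shifted_eulerian n 1) x - poly (shifted_eulerian n (1 - 1 / real r)) x)"
proof -
  have "[:1, -1:] * reversal (n - 1) (colored_eulerian_plus r n)
      = smult (real r ^ n) (shifted_eulerian n (real r / real r) - shifted_eulerian n ((real r - 1) / real r))"
    by (rule shifted_eulerian_diff[OF assms(1) fps_of_poly_reversal_colored_eulerian_plus[OF assms]])
  also have "real r / real r = 1"
    using assms by simp
  also have "(real r - 1) / real r = 1 - 1 / real r"
    using assms by (simp add: field_simps)
  finally have "[:1, -1:] * reversal (n - 1) (colored_eulerian_plus r n)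
      = smult (real r ^ n) (shifted_eulerian n 1 - shifted_eulerian n (1 - 1 / real r))" .
  from arg_cong[OF this, of "\<lambda>p. poly p x"] show ?thesis
    by (simp add: algebra_simps)
qed

lemma
  assumes "r > 0" "n > 0"
  shows degree_reversal_colored_eulerian_plus:
      "degree (reversal (n - 1) (colored_eulerian_plus r n)) = n - 1"
    and lead_coeff_reversal_colored_eulerian_plus:
      "lead_coeff (reversal (n - 1) (colored_eulerian_plus r n)) > 0"
  using degree_colored_eulerian_plus[OF assms] coeff_0_colored_eulerian_plus[OF assms]
  by (simp_all add: reversal_def coeff_reflect_poly)

theorem proposition5p8:
  fixes r n :: nat
  assumes "r \<ge> 2" and "n \<ge> 1"
  shows "reversal (n - 1) (colored_eulerian_plus r n) \<lless>\<^sub>p colored_eulerian_plus r n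
       \<and> alternatingly_increasing (colored_eulerian_plus r n)"
proof
  have r: "r > 0" and n: "n > 0"
    using assms by auto
  show "alternatingly_increasing (colored_eulerian_plus r n)"
    by (rule alternatingly_increasing_colored_eulerian_plus[OF r n])
  obtain m where m: "n = Suc m"
    using n gr0_implies_Suc by blast
  define h where "h = 1 / real r"
  \<comment> \<open>The inequality \<open>h \<le> 1 - h\<close> is where r >= 2 enters.\<close>
  have h: "0 < h" "h < 1" "h \<le> 1 - h"
    using assms by (auto simp: h_def field_simps)
  define p where "p = colored_eulerian_plus r n"
  define q where "q = reversal (n - 1) p"
  have p: "(1 - x) * poly p x
      = real r ^ n * (poly (shifted_eulerian n h) x - poly (shifted_eulerian n 0) x)" for x
    unfolding p_def h_def by (rule poly_colored_eulerian_plus[OF r])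
  have q: "(1 - x) * poly q x
      = real r ^ n * (poly (shifted_eulerian n 1) x - poly (shifted_eulerian n (1 - h)) x)" for x
    unfolding q_def p_def h_def by (rule poly_reversal_colored_eulerian_plus[OF r n])
  obtain y where y: "desc_roots (eulerian n) m y" "\<And>i. i < m \<Longrightarrow> y i < 0"
    "\<And>i. i < m \<Longrightarrow> 0 < (-1) ^ i * poly (eulerian m) (y i)"
    unfolding m by (rule eulerian_roots[of m]) blast
  define x where "x = case_nat 0 y"
  have x_less: "x (Suc i) < x i" if "i < m" for i
    using that y(2) desc_roots_less[OF y(1)] by (cases i) (auto simp: x_def)
  \<comment> \<open>At a zero of the Eulerian polynomial the term with shift 0 vanishes, so
    \<open>p\<close> is a positive multiple of the one with shift \<open>h\<close>. The sample
    \<open>x (Suc k)\<close> is \<open>y k\<close>, hence the change from \<open>k\<close> to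
    \<open>i\<close> in the exponent.\<close>
  have sgn_p: "0 < (-1) ^ i * poly p (x i)" if "i \<le> m" for i
  proof (cases i)
    case 0
    thus ?thesis
      using coeff_0_colored_eulerian_plus[OF r n] by (simp add: x_def p_def poly_0_coeff_0)
  next
    case (Suc k)
    hence k: "k < m"
      using that by simp
    let ?P = "poly (shifted_eulerian n h) (y k)" and ?e = "poly (eulerian m) (y k)"
    have "?P * ?e < 0"
      unfolding m
      using k h y(2)[OF k] y(3)[OF k] desc_roots_root[OF y(1) k]
      by (intro shifted_eulerian_sign_at_root) (auto simp: m)
    hence neg: "(-1) ^ k * ?P < 0"
      using y(3)[OF k] by (cases "even k") (auto simp: mult_less_0_iff)
    have eq: "(1 - y k) * poly p (y k) = real r ^ n * ?P"
      using desc_roots_root[OF y(1) k] n by (simp add: p shifted_eulerian_0)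
    have "(1 - y k) * ((-1) ^ i * poly p (x i)) = - ((-1) ^ k * ((1 - y k) * poly p (y k)))"
      using Suc by (simp add: x_def mult.left_commute)
    also have "\<dots> = real r ^ n * (- ((-1) ^ k * ?P))"
      by (simp add: eq mult.left_commute)
    also have "\<dots> > 0"
      using neg r by (intro mult_pos_pos) auto
    finally show ?thesis
      using y(2)[OF k] by (simp add: zero_less_mult_iff)
  qed
  obtain z where z: "desc_roots p m z" "\<And>i. i < m \<Longrightarrow> z i < x i"
    "\<And>i. Suc i < m \<Longrightarrow> x (Suc i) < z i"
  proof (rule desc_roots_of_sign_changes[where p = p and x = x])
    show "degree p = m" "lead_coeff p > 0"
      using degree_colored_eulerian_plus[OF r n] lead_coeff_colored_eulerian_plus[OF r n]
      by (auto simp: p_def m)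
  qed (use x_less sgn_p in auto)
  have z_neg: "z i < 0" if "i < m" for i
    using z(2)[OF that] y(2)[of "i - 1"] that by (cases i) (auto simp: x_def)
  \<comment> \<open>The sign changes leave the last zero without a lower bound. Were
    \<open>z i\<close> below \<open>y i\<close>, exactly \<open>i\<close> zeros would lie to the
    right of \<open>y i\<close>, giving \<open>p\<close> the wrong sign there.\<close>
  have y_less_z: "y i < z i" if i: "i < m" for i
  proof (rule ccontr)
    assume "\<not> y i < z i"
    moreover have "y i \<noteq> z i"
      using sgn_p[of "Suc i"] desc_roots_root[OF z(1) i] i by (auto simp: x_def)
    ultimately have "z i < y i"
      by simp
    moreover have "y i < z (i - 1)" if "i > 0"
      using z(3)[of "i - 1"] x_less[of i] that i by (simp add: x_def)
    ultimately have "0 < (-1) ^ i * poly p (y i)"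
      using i by (intro desc_roots_sign_between[OF z(1)]) auto
    thus False
      using sgn_p[of "Suc i"] i by (simp add: x_def)
  qed
  \<comment> \<open>Since \<open>z i\<close> lies between neighbouring zeros of the Eulerian
    polynomial, the sign of that polynomial there is known, and the reversal shares it.\<close>
  have sgn_q: "0 < (-1) ^ i * poly q (z i)" if i: "i < m" for i
  proof -
    have e: "0 < (-1) ^ i * poly (eulerian n) (z i)"
    proof (rule desc_roots_sign_between[OF y(1)])
      show "z i < y (i - 1)" if "i > 0"
        using z(2)[OF i] that by (cases i) (auto simp: x_def)
    qed (use i y_less_z in auto)
    have "poly (shifted_eulerian n h) (z i) = poly (shifted_eulerian n 0) (z i)"
      using p[of "z i"] desc_roots_root[OF z(1) i] r by simp
    hence "0 < (poly (shifted_eulerian n 1) (z i) - poly (shifted_eulerian n (1 - h)) (z i))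
        * poly (eulerian n) (z i)"
      unfolding m using e h z_neg[OF i] i
      by (intro shifted_eulerian_sign_after_turning) (auto simp: m)
    hence "0 < real r ^ n * ((poly (shifted_eulerian n 1) (z i) - poly (shifted_eulerian n (1 - h)) (z i))
        * poly (eulerian n) (z i))"
      using r by simp
    hence "0 < (1 - z i) * (poly q (z i) * poly (eulerian n) (z i))"
      by (simp only: q mult.assoc[symmetric])
    hence "0 < poly q (z i) * poly (eulerian n) (z i)"
      using z_neg[OF i] by (simp add: zero_less_mult_iff)
    thus ?thesis
      using e by (cases "even i") (auto simp: zero_less_mult_iff)
  qed
  obtain w where w: "desc_roots q m w" "\<And>i. i < m \<Longrightarrow> w i < z i"
    "\<And>i. Suc i < m \<Longrightarrow> z (Suc i) < w i"
  proof (rule desc_roots_of_sign_changes[where p = q and x = z])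
    show "degree q = m" "lead_coeff q > 0"
      using degree_reversal_colored_eulerian_plus[OF r n]
        lead_coeff_reversal_colored_eulerian_plus[OF r n]
      by (auto simp: q_def p_def m)
  qed (use desc_roots_less[OF z(1)] sgn_q in auto)
  show "reversal (n - 1) (colored_eulerian_plus r n) \<lless>\<^sub>p colored_eulerian_plus r n"
    unfolding p_def[symmetric] q_def[symmetric]
    by (rule signed_interlaces_desc_roots[OF z(1) w(1)]) (use w in \<open>auto intro: less_imp_le\<close>)
qed

end
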